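(* Let $p$ be a vector of positive prices and let $f$ be a balanced flow in $N_p$ with surplus vector $r$. Let $S>0$, let $B(S)=\{b_i\in B: r(b_i)\ge S\}$ and let $\Gamma(B(S))=\{c_j\in C: (b_i,c_j)\in E_p \text{ for some } b_i\in B(S)\}$. Let $$x_{eq}(S)=\min\Big\{\frac{u_{ij}}{p_j}\cdot\frac{p_k}{u_{ik}} : b_i\in B(S),\ (b_i,c_j)\in E_p,\ c_k\notin\Gamma(B(S))\Big\}.$$ Let $x>1$ satisfy $x\le \min\{p_i/(p_i-r(b_i)) : b_i\in B(S),\ c_i\notin\Gamma(B(S))\}$ and $x\le x_{eq}(S)$. Define new prices $p'_j=x p_j$ if $c_j\in\Gamma(B(S))$ and $p'_j=p_j$ otherwise, and define $f'$ by $f'_{ij}=x f_{ij}$ if $c_j\in\Gamma(B(S))$ and $f'_{ij}=f_{ij}$ otherwise; $f'_{jt}=x f_{jt}$ if $c_j\in\Gamma(B(S))$ and $f'_{jt}=f_{jt}$ otherwise; $f'_{si}=x f_{si}$ if $b_i\in B(S)$ and $f'_{si}=f_{si}$ otherwise. Then $f'$ is a feasible flow in the equality network $N_{p'}$ (capacity and conservation constraints hold, and every edge $(b_i,c_j)$ with $f'_{ij}>0$ belongs to $E_{p'}$). With respect to $f'$ and $p'$, the surplus of every good is the same as with respect to $f$ and $p$, and the surpluses $r'$ of the buyers are $$r'(b_i)=\begin{cases} x\, r(b_i) & \text{if } b_i\in B(S),\ c_i\in\Gamma(B(S)),\\ (1-x)p_i+x\, r(b_i) & \text{if } b_i\in B(S),\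 c_i\notin\Gamma(B(S)),\\ (x-1)p_i+r(b_i) & \text{if } b_i\notin B(S),\ c_i\in\Gamma(B(S)),\\ r(b_i) & \text{if } b_i\notin B(S),\ c_i\notin\Gamma(B(S)).\end{cases}$$
   Context: Setting: $n$ agents; agent $i$ owns one unit of good $i$; $u_{ij}\ge 0$ is the utility to agent $i$ of all of good $j$. Each agent $i$ is represented as a buyer $b_i$ (set $B$) and as a good $c_i$ (set $C$). For a positive price vector $p$, the bang per buck of $b_i$ is $\alpha_i=\max_j u_{ij}/p_j$, and $E_p=\{(b_i,c_j): u_{ij}/p_j=\alpha_i\}$ (equality edges). The equality network $N_p$ has vertices $\{s,t\}\cup B\cup C$, an edge $(s,b_i)$ of capacity $p_i$ for each $i$, an edge $(c_i,t)$ of capacity $p_i$ for each $i$, and an edge $(b_i,c_j)$ of infinite capacity for each $(b_i,c_j)\in E_p$. For a flow $f$ (with $f_{si}$, $f_{ij}$, $f_{jt}$ the flows on $(s,b_i)$, $(b_i,c_j)$, $(c_j,t)$), the surplus of buyer $b_i$ is $r(b_i)=p_i-\sum_j f_{ij}$ and the surplus of good $c_j$ is $r(c_j)=p_j-\sum_i f_{ij}$; $r(B)=(r(b_1),\ldots,r(b_n))$. A balanced flow in $N_p$ is a maximum $s$-$t$ flow in $N_p$ minimizing the Euclidean norm $\|r(B)\|$ among all maximum flows. Minima over empty sets are $+\infty$, and a quotient $p_i/(p_i-r(b_i))$ with zero denominator is read as $+\infty$. *)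

theory Defs
  imports "HOL-Analysis.Analysis"
begin

record 'v network =
  source :: 'v
  sink :: 'v
  edges :: "('v \<times> 'v) set"
  cap :: "'v \<times> 'v \<Rightarrow> ereal"

definition feasible_flow :: "'v::finite network \<Rightarrow> ('v \<times> 'v \<Rightarrow> real) \<Rightarrow> bool" where
  "feasible_flow N f \<longleftrightarrow>
     (\<forall>e \<in> edges N. 0 \<le> f e \<and> ereal (f e) \<le> cap N e) \<and>
     (\<forall>e. e \<notin> edges N \<longrightarrow> f e = 0) \<and>
     (\<forall>v. v \<noteq> source N \<longrightarrow> v \<noteq> sink N \<longrightarrow> (\<Sum>w\<in>UNIV. f (w, v)) = (\<Sum>w\<in>UNIV. f (v, w)))"

definition flow_value :: "'v::finite network \<Rightarrow> ('v \<times> 'v \<Rightarrow> real) \<Rightarrow> real" where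
  "flow_value N f = (\<Sum>w\<in>UNIV. f (source N, w)) - (\<Sum>w\<in>UNIV. f (w, source N))"

definition maximum_flow :: "'v::finite network \<Rightarrow> ('v \<times> 'v \<Rightarrow> real) \<Rightarrow> bool" where
  "maximum_flow N f \<longleftrightarrow>
     feasible_flow N f \<and> (\<forall>g. feasible_flow N g \<longrightarrow> flow_value N g \<le> flow_value N f)"

text \<open>
  The agents are the elements of a finite type \<open>'n\<close>, so that \<open>n = CARD('n)\<close>. Agent \<open>i\<close> gives rise to
  the two vertices \<open>Buyer i\<close> and \<open>Good i\<close>. Sets of buyers and sets of goods are represented by the
  corresponding sets of indices.
\<close>

datatype 'n vertex = Source | Sink | Buyer 'n | Good 'n

instance vertex :: (finite) finite
proof
  have "(UNIV :: 'a vertex set) = {Source, Sink} \<union> range Buyer \<union> range Good"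
    by (auto intro: vertex.exhaust)
  then show "finite (UNIV :: 'a vertex set)"
    by (metis finite_Un finite.emptyI finite.insertI finite_imageI finite_class.finite_UNIV)
qed

definition bang_per_buck :: "('n::finite \<Rightarrow> 'n \<Rightarrow> real) \<Rightarrow> ('n \<Rightarrow> real) \<Rightarrow> 'n \<Rightarrow> real" where
  "bang_per_buck u p i = Max (range (\<lambda>j. u i j / p j))"

definition equality_edges :: "('n::finite \<Rightarrow> 'n \<Rightarrow> real) \<Rightarrow> ('n \<Rightarrow> real) \<Rightarrow> ('n \<times> 'n) set" where
  "equality_edges u p = {(i, j). u i j / p j = bang_per_buck u p i}"

fun equality_cap :: "('n \<Rightarrow> real) \<Rightarrow> 'n vertex \<times> 'n vertex \<Rightarrow> ereal" where
  "equality_cap p (Source, Buyer i) = ereal (p i)"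
| "equality_cap p (Good i, Sink) = ereal (p i)"
| "equality_cap p (Buyer i, Good j) = \<infinity>"
| "equality_cap p _ = 0"

definition equality_network ::
  "('n::finite \<Rightarrow> 'n \<Rightarrow> real) \<Rightarrow> ('n \<Rightarrow> real) \<Rightarrow> 'n vertex network" where
  "equality_network u p =
     \<lparr> source = Source,
       sink = Sink,
       edges = range (\<lambda>i. (Source, Buyer i)) \<union> range (\<lambda>i. (Good i, Sink)) \<union>
               {(Buyer i, Good j) | i j. (i, j) \<in> equality_edges u p},
       cap = equality_cap p \<rparr>"

definition buyer_surplus ::
  "('n::finite \<Rightarrow> real) \<Rightarrow> ('n vertex \<times> 'n vertex \<Rightarrow> real) \<Rightarrow> 'n \<Rightarrow> real" where
  "buyer_surplus p f i = p i - (\<Sum>j\<in>UNIV. f (Buyer i, Good j))"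

definition good_surplus ::
  "('n::finite \<Rightarrow> real) \<Rightarrow> ('n vertex \<times> 'n vertex \<Rightarrow> real) \<Rightarrow> 'n \<Rightarrow> real" where
  "good_surplus p f j = p j - (\<Sum>i\<in>UNIV. f (Buyer i, Good j))"

definition buyer_surplus_vector ::
  "('n::finite \<Rightarrow> real) \<Rightarrow> ('n vertex \<times> 'n vertex \<Rightarrow> real) \<Rightarrow> real ^ 'n" where
  "buyer_surplus_vector p f = (\<chi> i. buyer_surplus p f i)"

definition balanced_flow ::
  "('n::finite \<Rightarrow> 'n \<Rightarrow> real) \<Rightarrow> ('n \<Rightarrow> real) \<Rightarrow> ('n vertex \<times> 'n vertex \<Rightarrow> real) \<Rightarrow> bool" where
  "balanced_flow u p f \<longleftrightarrow>
     maximum_flow (equality_network u p) f \<and>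
     (\<forall>g. maximum_flow (equality_network u p) g \<longrightarrow>
        norm (buyer_surplus_vector p f) \<le> norm (buyer_surplus_vector p g))"

definition high_surplus_buyers ::
  "('n::finite \<Rightarrow> real) \<Rightarrow> ('n vertex \<times> 'n vertex \<Rightarrow> real) \<Rightarrow> real \<Rightarrow> 'n set" where
  "high_surplus_buyers p f S = {i. S \<le> buyer_surplus p f i}"

definition neighbour_goods ::
  "('n::finite \<Rightarrow> 'n \<Rightarrow> real) \<Rightarrow> ('n \<Rightarrow> real) \<Rightarrow> 'n set \<Rightarrow> 'n set" where
  "neighbour_goods u p A = {j. \<exists>i\<in>A. (i, j) \<in> equality_edges u p}"

text \<open>
  The two bounds on the price increase are minima of finite sets of extended reals; \<open>Inf\<close> is used
  because it gives \<open>\<infinity>\<close> on the empty set. Denominators are embedded into \<^typ>\<open>ereal\<close> before dividing,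
  because there \<open>a / 0 = \<infinity>\<close> for \<open>a > 0\<close>, whereas \<open>a / 0 = 0\<close> in \<^typ>\<open>real\<close>. In \<open>x_eq\<close> this applies
  when \<open>u i k = 0\<close>; then \<open>u i j > 0\<close>, as otherwise every good would be an equality good of buyer \<open>i\<close>.
\<close>

definition x_eq ::
  "('n::finite \<Rightarrow> 'n \<Rightarrow> real) \<Rightarrow> ('n \<Rightarrow> real) \<Rightarrow> 'n set \<Rightarrow> ereal" where
  "x_eq u p A =
     Inf {ereal (u i j / p j) * (ereal (p k) / ereal (u i k)) | i j k.
            i \<in> A \<and> (i, j) \<in> equality_edges u p \<and> k \<notin> neighbour_goods u p A}"

definition x_surplus ::
  "('n::finite \<Rightarrow> 'n \<Rightarrow> real) \<Rightarrow> ('n \<Rightarrow> real) \<Rightarrow> ('n vertex \<times> 'n vertex \<Rightarrow> real) \<Rightarrow> 'n set \<Rightarrow> ereal"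
where
  "x_surplus u p f A =
     Inf {ereal (p i) / ereal (p i - buyer_surplus p f i) | i.
            i \<in> A \<and> i \<notin> neighbour_goods u p A}"

definition scaled_prices :: "('n \<Rightarrow> real) \<Rightarrow> 'n set \<Rightarrow> real \<Rightarrow> 'n \<Rightarrow> real" where
  "scaled_prices p G x j = (if j \<in> G then x * p j else p j)"

fun scaled_flow ::
  "('n vertex \<times> 'n vertex \<Rightarrow> real) \<Rightarrow> 'n set \<Rightarrow> 'n set \<Rightarrow> real \<Rightarrow> 'n vertex \<times> 'n vertex \<Rightarrow> real"
where
  "scaled_flow f A G x (Source, Buyer i) =
     (if i \<in> A then x * f (Source, Buyer i) else f (Source, Buyer i))"
| "scaled_flow f A G x (Buyer i, Good j) =
     (if j \<in> G then x * f (Buyer i, Good j) else f (Buyer i, Good j))"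
| "scaled_flow f A G x (Good j, Sink) =
     (if j \<in> G then x * f (Good j, Sink) else f (Good j, Sink))"
| "scaled_flow f A G x _ = 0"

end

theory Submission
  imports Defs
begin

text \<open>
  A feasible flow in the equality network is determined by the matrix of its flows from buyers to
  goods. Balancedness enters only through two exchange arguments at an equality edge
  \<open>(b\<^sub>i, c\<^sub>j)\<close> with \<open>b\<^sub>i\<close> in \<open>B(S)\<close>. If \<open>c\<^sub>j\<close> had positive surplus, more flow could be pushed along the
  edge, so the flow would not be maximum. If a buyer outside \<open>B(S)\<close> sent flow to \<open>c\<^sub>j\<close>, rerouting
  part of the demand for \<open>c\<^sub>j\<close> to \<open>b\<^sub>i\<close> would keep the flow maximum and decrease the norm of the
  surplus vector. Hence the goods in \<open>\<Gamma>(B(S))\<close> are sold completely, and only to buyers in \<open>B(S)\<close>, who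
  buy nothing else, so prices and flows can be scaled together. The bound \<open>x_eq\<close> says that
  the goods of \<open>\<Gamma>(B(S))\<close> remain optimal for \<open>B(S)\<close>, and \<open>x_surplus\<close> that no buyer overspends.
\<close>

section \<open>Flows in the equality network as matrices\<close>

fun flow_of_matrix :: "('n::finite \<Rightarrow> 'n \<Rightarrow> real) \<Rightarrow> 'n vertex \<times> 'n vertex \<Rightarrow> real" where
  "flow_of_matrix h (Source, Buyer i) = (\<Sum>j\<in>UNIV. h i j)"
| "flow_of_matrix h (Buyer i, Good j) = h i j"
| "flow_of_matrix h (Good j, Sink) = (\<Sum>i\<in>UNIV. h i j)"
| "flow_of_matrix h _ = 0"

lemma sum_vertex:
  fixes g :: "'n::finite vertex \<Rightarrow> 'a::comm_monoid_add"
  shows "(\<Sum>v\<in>UNIV. g v) =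
    g Source + g Sink + (\<Sum>i\<in>UNIV. g (Buyer i)) + (\<Sum>i\<in>UNIV. g (Good i))"
proof -
  have U: "(UNIV :: 'n vertex set) = {Source, Sink} \<union> (range Buyer \<union> range Good)"
    by (auto intro: vertex.exhaust)
  have "(\<Sum>v\<in>UNIV. g v) = sum g {Source, Sink} + (sum g (range Buyer) + sum g (range Good))"
    unfolding U by (subst sum.union_disjoint; auto simp: sum.union_disjoint)+
  then show ?thesis
    by (simp add: sum.reindex inj_def add.assoc)
qed

text \<open>Conservation is built into \<open>flow_of_matrix\<close>, and the buyer-good edges have
  infinite capacity. What remains is sign, support, and one bound per row (budget) and per column
  (supply).\<close>

lemma feasible_flow_of_matrix_iff:
  "feasible_flow (equality_network u p) (flow_of_matrix h) \<longleftrightarrow>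
    (\<forall>i j. 0 \<le> h i j) \<and> (\<forall>i j. (i, j) \<notin> equality_edges u p \<longrightarrow> h i j = 0) \<and>
    (\<forall>i. (\<Sum>j\<in>UNIV. h i j) \<le> p i) \<and> (\<forall>j. (\<Sum>i\<in>UNIV. h i j) \<le> p j)" (is "?L \<longleftrightarrow> ?R")
proof
  assume L: ?L
  have off: "h i j = 0" if "(i, j) \<notin> equality_edges u p" for i j
  proof -
    have "(Buyer i, Good j) \<notin> edges (equality_network u p)"
      using that by (auto simp: equality_network_def)
    then have "flow_of_matrix h (Buyer i, Good j) = 0"
      using L unfolding feasible_flow_def by blast
    then show ?thesis by simp
  qed
  have e: "0 \<le> flow_of_matrix h e \<and> ereal (flow_of_matrix h e) \<le> equality_cap p e"
    if "e \<in> edges (equality_network u p)" for e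
    using L that unfolding feasible_flow_def by (auto simp: equality_network_def)
  have "0 \<le> h i j" for i j
  proof (cases "(i, j) \<in> equality_edges u p")
    case True
    then show ?thesis
      using e[of "(Buyer i, Good j)"] by (auto simp: equality_network_def)
  qed (simp add: off)
  moreover have "(\<Sum>j\<in>UNIV. h i j) \<le> p i" for i
    using e[of "(Source, Buyer i)"] by (simp add: equality_network_def)
  moreover have "(\<Sum>i\<in>UNIV. h i j) \<le> p j" for j
    using e[of "(Good j, Sink)"] by (simp add: equality_network_def)
  ultimately show ?R
    using off by blast
next
  assume R: ?R
  have "(\<Sum>w\<in>UNIV. flow_of_matrix h (w, v)) = (\<Sum>w\<in>UNIV. flow_of_matrix h (v, w))"
    if "v \<noteq> Source" "v \<noteq> Sink" for v
    using that by (cases v) (simp_all add: sum_vertex)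
  moreover have "flow_of_matrix h e = 0" if "e \<notin> edges (equality_network u p)" for e
    using that R by (cases "(h, e)" rule: flow_of_matrix.cases) (auto simp: equality_network_def)
  ultimately show ?L
    using R unfolding feasible_flow_def by (auto simp: equality_network_def intro!: sum_nonneg)
qed

text \<open>A buyer has a single incoming edge and a good a single outgoing one, so conservation
  forces the flow on these edges.\<close>

lemma feasible_flow_eq_flow_of_matrix:
  assumes "feasible_flow (equality_network u p) f"
  shows "f = flow_of_matrix (\<lambda>i j. f (Buyer i, Good j))"
proof
  fix e
  have off: "f e = 0" if "e \<notin> edges (equality_network u p)" for e
    using assms that unfolding feasible_flow_def by blast
  have cons: "(\<Sum>w\<in>UNIV. f (w, v)) = (\<Sum>w\<in>UNIV. f (v, w))" if "v \<noteq> Source" "v \<noteq> Sink" for v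
    using assms that unfolding feasible_flow_def by (simp add: equality_network_def)
  have "f (Source, Buyer i) = (\<Sum>j\<in>UNIV. f (Buyer i, Good j))" for i
    using cons[of "Buyer i"] by (simp add: sum_vertex off equality_network_def image_iff)
  moreover have "f (Good j, Sink) = (\<Sum>i\<in>UNIV. f (Buyer i, Good j))" for j
    using cons[of "Good j"] by (simp add: sum_vertex off equality_network_def image_iff)
  ultimately show "f e = flow_of_matrix (\<lambda>i j. f (Buyer i, Good j)) e"
    by (cases "(\<lambda>i j. f (Buyer i, Good j), e)" rule: flow_of_matrix.cases)
      (auto intro!: off simp: equality_network_def)
qed

lemma flow_value_flow_of_matrix:
  "flow_value (equality_network u p) (flow_of_matrix h) = (\<Sum>i\<in>UNIV. \<Sum>j\<in>UNIV. h i j)"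
  by (simp add: flow_value_def equality_network_def sum_vertex)

lemma feasible_flow_matrix:
  assumes "feasible_flow (equality_network u p) f"
  shows "0 \<le> f (Buyer i, Good j)"
    and "(i, j) \<notin> equality_edges u p \<Longrightarrow> f (Buyer i, Good j) = 0"
    and "0 \<le> buyer_surplus p f i"
    and "0 \<le> good_surplus p f j"
  using assms
  by (subst (asm) feasible_flow_eq_flow_of_matrix[OF assms],
      simp add: feasible_flow_of_matrix_iff buyer_surplus_def good_surplus_def)+

section \<open>Exchange arguments for maximum and balanced flows\<close>

lemma maximum_flow_good_surplus:
  assumes max: "maximum_flow (equality_network u p) f"
    and ij: "(i, j) \<in> equality_edges u p"
    and pos: "0 < buyer_surplus p f i"
  shows "good_surplus p f j = 0"
proof (rule ccontr)
  assume ne: "good_surplus p f j \<noteq> 0"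
  define h where "h = (\<lambda>i j. f (Buyer i, Good j))"
  have feas: "feasible_flow (equality_network u p) f"
    using max by (simp add: maximum_flow_def)
  note f = feasible_flow_eq_flow_of_matrix[OF feas, folded h_def]
  note m = feasible_flow_matrix[OF feas]
  \<comment> \<open>The residual capacity of the path from the source through buyer \<open>i\<close>
    and good \<open>j\<close> to the sink; \<open>g\<close> augments along this path.\<close>
  define d where "d = min (buyer_surplus p f i) (good_surplus p f j)"
  have d: "0 < d" "d \<le> buyer_surplus p f i" "d \<le> good_surplus p f j"
    using pos ne m(4)[of j] by (auto simp: d_def)
  define g where "g = (\<lambda>k l. h k l + (if k = i then if l = j then d else 0 else 0))"
  have row: "(\<Sum>l\<in>UNIV. g k l) = (\<Sum>l\<in>UNIV. h k l) + (if k = i then d else 0)" for k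
    by (simp add: g_def sum.distrib)
  have col: "(\<Sum>k\<in>UNIV. g k l) = (\<Sum>k\<in>UNIV. h k l) + (if l = j then d else 0)" for l
    by (simp add: g_def sum.distrib)
  have "feasible_flow (equality_network u p) (flow_of_matrix g)"
    unfolding feasible_flow_of_matrix_iff row col
  proof (intro conjI allI impI)
    fix k l
    show "0 \<le> g k l" using m(1)[of k l] d by (simp add: g_def h_def)
    show "g k l = 0" if "(k, l) \<notin> equality_edges u p"
      using m(2)[OF that] that ij by (auto simp: g_def h_def)
    show "(\<Sum>l\<in>UNIV. h k l) + (if k = i then d else 0) \<le> p k"
      using m(3)[of k] d by (auto simp: h_def buyer_surplus_def)
    show "(\<Sum>k\<in>UNIV. h k l) + (if l = j then d else 0) \<le> p l"
      using m(4)[of l] d by (auto simp: h_def good_surplus_def)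
  qed
  then have "flow_value (equality_network u p) (flow_of_matrix g) \<le>
      flow_value (equality_network u p) (flow_of_matrix h)"
    using max unfolding maximum_flow_def f[symmetric] by blast
  then show False
    using d by (simp add: flow_value_flow_of_matrix row sum.distrib)
qed

lemma balanced_flow_no_lower_surplus_buyer:
  assumes bal: "balanced_flow u p f"
    and ij: "(i, j) \<in> equality_edges u p"
    and less: "buyer_surplus p f k < buyer_surplus p f i"
  shows "f (Buyer k, Good j) = 0"
proof (rule ccontr)
  assume ne: "f (Buyer k, Good j) \<noteq> 0"
  define h where "h = (\<lambda>i j. f (Buyer i, Good j))"
  have max: "maximum_flow (equality_network u p) f"
    using bal by (simp add: balanced_flow_def)
  then have feas: "feasible_flow (equality_network u p) f"
    by (simp add: maximum_flow_def)
  note f = feasible_flow_eq_flow_of_matrix[OF feas, folded h_def]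
  note m = feasible_flow_matrix[OF feas]
  let ?r = "buyer_surplus p f"
  \<comment> \<open>The first bound keeps the entry of buyer \<open>k\<close> nonnegative. Halving
    the gap makes \<open>d\<close> strictly smaller than the gap, so that the squared norm drops
    strictly.\<close>
  define d where "d = min (h k j) ((?r i - ?r k) / 2)"
  have d: "0 < d" "d \<le> h k j" "d < ?r i - ?r k"
    using ne less m(1)[of k j] by (auto simp: d_def h_def min_def)
  have kj: "(k, j) \<in> equality_edges u p"
    using m(2) ne by blast
  have ik: "i \<noteq> k" using less by auto
  \<comment> \<open>\<open>D\<close> is the change in column \<open>j\<close>, and also the change
    in the row sums. It sums to zero, so no good gains or loses flow and the flow value is
    preserved.\<close>
  define D where "D = (\<lambda>l. if l = i then d else if l = k then - d else 0)"
  have D0: "(\<Sum>l\<in>UNIV. D l) = 0"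
  proof -
    have "D = (\<lambda>l. (if l = i then d else 0) + (if l = k then - d else 0))"
      using ik by (auto simp: D_def)
    then show ?thesis by (simp add: sum.distrib)
  qed
  define g where "g = (\<lambda>a b. h a b + (if b = j then D a else 0))"
  have row: "(\<Sum>b\<in>UNIV. g a b) = (\<Sum>b\<in>UNIV. h a b) + D a" for a
    by (simp add: g_def sum.distrib)
  have col: "(\<Sum>a\<in>UNIV. g a b) = (\<Sum>a\<in>UNIV. h a b)" for b
    using D0 by (cases "b = j") (simp_all add: g_def sum.distrib)
  have "feasible_flow (equality_network u p) (flow_of_matrix g)"
    unfolding feasible_flow_of_matrix_iff row col
  proof (intro conjI allI impI)
    fix a b
    show "0 \<le> g a b" using m(1)[of a b] d by (auto simp: g_def h_def D_def)
    show "g a b = 0" if "(a, b) \<notin> equality_edges u p"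
      using m(2)[OF that] that ij kj by (auto simp: g_def h_def D_def)
    \<comment> \<open>Buyer \<open>i\<close> can afford \<open>d\<close> because \<open>d\<close> is
      below the gap and the surplus of \<open>k\<close> is nonnegative, so \<open>d\<close> is below
      the surplus of \<open>i\<close>.\<close>
    show "(\<Sum>b\<in>UNIV. h a b) + D a \<le> p a"
      using m(3)[of a] m(3)[of k] d by (auto simp: h_def buyer_surplus_def D_def)
    show "(\<Sum>a\<in>UNIV. h a b) \<le> p b"
      using m(4)[of b] by (auto simp: h_def good_surplus_def)
  qed
  moreover have "flow_value (equality_network u p) (flow_of_matrix g) =
      flow_value (equality_network u p) f"
    by (subst f) (simp add: flow_value_flow_of_matrix row sum.distrib D0)
  ultimately have "maximum_flow (equality_network u p) (flow_of_matrix g)"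
    using max by (simp add: maximum_flow_def)
  then have "norm (buyer_surplus_vector p f) \<le> norm (buyer_surplus_vector p (flow_of_matrix g))"
    using bal by (simp add: balanced_flow_def)
  moreover have "buyer_surplus p (flow_of_matrix g) a = ?r a - D a" for a
    by (simp add: buyer_surplus_def row) (simp add: h_def)
  ultimately have "(\<Sum>a\<in>UNIV. ?r a * ?r a) \<le> (\<Sum>a\<in>UNIV. (?r a - D a) * (?r a - D a))"
    by (simp add: norm_le inner_vec_def buyer_surplus_vector_def)
  \<comment> \<open>Only the squares at \<open>i\<close> and \<open>k\<close> change; the two
    conditionals are their increments.\<close>
  also have "\<dots> = (\<Sum>a\<in>UNIV. ?r a * ?r a + ((if a = i then d * d - 2 * d * ?r i else 0)
      + (if a = k then d * d + 2 * d * ?r k else 0)))"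
    using ik by (intro sum.cong) (auto simp: D_def algebra_simps)
  also have "\<dots> = (\<Sum>a\<in>UNIV. ?r a * ?r a) + 2 * d * (d - (?r i - ?r k))"
    by (simp add: sum.distrib algebra_simps)
  finally have "0 \<le> 2 * d * (d - (?r i - ?r k))" by simp
  then show False
    using d by (simp add: zero_le_mult_iff)
qed

section \<open>Equality edges under the price change\<close>

lemma bang_per_buck_ge: "u i j / p j \<le> bang_per_buck u p i"
  unfolding bang_per_buck_def by (rule Max_ge) auto

lemma mem_equality_edges_iff:
  "(i, j) \<in> equality_edges u p \<longleftrightarrow> (\<forall>k. u i k / p k \<le> u i j / p j)"
proof
  assume "(i, j) \<in> equality_edges u p"
  then show "\<forall>k. u i k / p k \<le> u i j / p j"
    using bang_per_buck_ge[of u i _ p] by (simp add: equality_edges_def)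
next
  assume "\<forall>k. u i k / p k \<le> u i j / p j"
  then have "bang_per_buck u p i = u i j / p j"
    unfolding bang_per_buck_def by (intro Max_eqI) auto
  then show "(i, j) \<in> equality_edges u p"
    by (simp add: equality_edges_def)
qed

text \<open>Raising the prices in \<Gamma>(A) divides all ratios there by \<open>x\<close>, which
  keeps their order. Ratios of other goods stay fixed, and \<open>x_eq\<close> marks the first
  moment when one of them catches up.\<close>

lemma scaled_prices_equality_edge_inside:
  assumes u: "\<And>i j. 0 \<le> u i j" and p: "\<And>i. 0 < p i" and x: "1 < x"
    and xeq: "ereal x \<le> x_eq u p A"
    and i: "i \<in> A" and ij: "(i, j) \<in> equality_edges u p"
  shows "(i, j) \<in> equality_edges u (scaled_prices p (neighbour_goods u p A) x)"
proof -
  let ?G = "neighbour_goods u p A"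
  have j: "j \<in> ?G"
    using i ij by (auto simp: neighbour_goods_def)
  have "u i k / scaled_prices p ?G x k \<le> u i j / (x * p j)" for k
  proof (cases "k \<in> ?G")
    case True
    have "u i k / p k \<le> u i j / p j"
      using ij by (simp add: mem_equality_edges_iff)
    then have "(u i k / p k) / x \<le> (u i j / p j) / x"
      using x by (intro divide_right_mono) auto
    then show ?thesis
      using True by (simp add: scaled_prices_def mult.commute)
  next
    case False
    show ?thesis
    proof (cases "u i k = 0")
      \<comment> \<open>The quotient in \<open>x_eq\<close> has denominator zero here, but a
        worthless good cannot beat good \<open>j\<close>.\<close>
      case True
      then show ?thesis
        using u[of i j] p[of j] x by simp
    next
      case nz: False
      have "ereal x \<le> ereal (u i j / p j) * (ereal (p k) / ereal (u i k))"
        using i ij False by (intro order_trans[OF xeq[unfolded x_eq_def]] Inf_lower) blast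
      then have "x \<le> u i j / p j * (p k / u i k)"
        using nz by simp
      moreover have "0 < u i k" using u[of i k] nz by simp
      ultimately show ?thesis
        using False p[of j] p[of k] x by (simp add: scaled_prices_def field_simps)
    qed
  qed
  then show ?thesis
    using j by (simp add: mem_equality_edges_iff scaled_prices_def)
qed

text \<open>The ratio of \<open>j\<close> is unchanged, while price increases can only lower the
  competing ratios.\<close>

lemma scaled_prices_equality_edge_outside:
  assumes u: "\<And>i j. 0 \<le> u i j" and p: "\<And>i. 0 < p i" and x: "1 < x"
    and j: "j \<notin> G" and ij: "(i, j) \<in> equality_edges u p"
  shows "(i, j) \<in> equality_edges u (scaled_prices p G x)"
proof -
  have "u i k / scaled_prices p G x k \<le> u i k / p k" for k
    using u[of i k] p[of k] x by (auto simp: scaled_prices_def intro!: divide_left_mono)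
  also have "u i k / p k \<le> u i j / p j" for k
    using ij by (simp add: mem_equality_edges_iff)
  finally show ?thesis
    using j by (simp add: mem_equality_edges_iff scaled_prices_def)
qed

section \<open>Feasibility and surpluses of the scaled flow\<close>

theorem theorem1:
  fixes u :: "'n::finite \<Rightarrow> 'n \<Rightarrow> real"
    and p p' :: "'n \<Rightarrow> real"
    and f f' :: "'n vertex \<times> 'n vertex \<Rightarrow> real"
    and S x :: real
    and BS G :: "'n set"
  assumes "\<And>i j. 0 \<le> u i j"
    and "\<And>i. 0 < p i"
    and "balanced_flow u p f"
    and "0 < S"
    and "BS = high_surplus_buyers p f S"
    and "G = neighbour_goods u p BS"
    and "1 < x"
    and "ereal x \<le> x_surplus u p f BS"
    and "ereal x \<le> x_eq u p BS"
    and "p' = scaled_prices p G x"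
    and "f' = scaled_flow f BS G x"
  shows "feasible_flow (equality_network u p') f' \<and>
    (\<forall>i j. 0 < f' (Buyer i, Good j) \<longrightarrow> (i, j) \<in> equality_edges u p') \<and>
    (\<forall>j. good_surplus p' f' j = good_surplus p f j) \<and>
    (\<forall>i. buyer_surplus p' f' i =
       (if i \<in> BS \<and> i \<in> G then x * buyer_surplus p f i
        else if i \<in> BS \<and> i \<notin> G then (1 - x) * p i + x * buyer_surplus p f i
        else if i \<notin> BS \<and> i \<in> G then (x - 1) * p i + buyer_surplus p f i
        else buyer_surplus p f i))"
proof -
  note u = assms(1) and p = assms(2) and bal = assms(3) and x = assms(7)
  let ?r = "buyer_surplus p f"
  have max: "maximum_flow (equality_network u p) f"
    using bal by (simp add: balanced_flow_def)
  then have feas: "feasible_flow (equality_network u p) f"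
    by (simp add: maximum_flow_def)
  define h where "h = (\<lambda>i j. f (Buyer i, Good j))"
  note f = feasible_flow_eq_flow_of_matrix[OF feas, folded h_def]
  note m = feasible_flow_matrix[OF feas]
  have BS: "i \<in> BS \<longleftrightarrow> S \<le> ?r i" for i
    by (simp add: assms(5) high_surplus_buyers_def)
  have G: "j \<in> G" if "i \<in> BS" "(i, j) \<in> equality_edges u p" for i j
    using that assms(6) by (auto simp: neighbour_goods_def)
  have sold: "good_surplus p f j = 0" if "j \<in> G" for j
    using that \<open>0 < S\<close> maximum_flow_good_surplus[OF max]
    unfolding assms(6) neighbour_goods_def by (force simp: BS)
  \<comment> \<open>A surplus below \<open>S\<close> is strictly less than that of every buyer in
    \<open>BS\<close>, which gives the gap needed for rerouting.\<close>
  have out: "h i j = 0" if "i \<notin> BS" "j \<in> G" for i j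
    using that balanced_flow_no_lower_surplus_buyer[OF bal]
    unfolding assms(6) neighbour_goods_def by (force simp: BS h_def)
  have inn: "h i j = 0" if "i \<in> BS" "j \<notin> G" for i j
    using that G m(2) unfolding h_def by blast
  define h' where "h' = (\<lambda>i j. if j \<in> G then x * h i j else h i j)"
  \<comment> \<open>By \<open>out\<close> and \<open>inn\<close> the nonzero entries of a row lie
    all inside \<open>G\<close> or all outside it, so scaling columns also scales each row
    uniformly. This matches the factor on the source edges and gives conservation for the scaled
    flow.\<close>
  have row: "(\<Sum>j\<in>UNIV. h' i j) = (if i \<in> BS then x else 1) * (\<Sum>j\<in>UNIV. h i j)" for i
    unfolding sum_distrib_left by (intro sum.cong) (auto simp: h'_def out inn)
  have col: "(\<Sum>i\<in>UNIV. h' i j) = (if j \<in> G then x else 1) * (\<Sum>i\<in>UNIV. h i j)" for j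
    unfolding sum_distrib_left by (intro sum.cong) (auto simp: h'_def)
  have f': "f' = flow_of_matrix h'"
  proof
    fix e
    show "f' e = flow_of_matrix h' e"
      unfolding assms(11)
      by (subst f, cases "(h', e)" rule: flow_of_matrix.cases) (simp_all add: row col, simp add: h'_def)
  qed
  have rh: "?r i = p i - (\<Sum>j\<in>UNIV. h i j)" for i
    by (simp add: buyer_surplus_def h_def)
  have gh: "good_surplus p f j = p j - (\<Sum>i\<in>UNIV. h i j)" for j
    by (simp add: good_surplus_def h_def)
  \<comment> \<open>Only edges carrying flow have to survive: an edge from a buyer outside
    \<open>BS\<close> into \<open>G\<close> may cease to be an equality edge, but \<open>out\<close>
    shows that it is empty.\<close>
  have E': "(i, j) \<in> equality_edges u p'" if "h' i j \<noteq> 0" for i j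
  proof -
    have ij: "(i, j) \<in> equality_edges u p"
      using that m(2) by (fastforce simp: h'_def h_def split: if_splits)
    show ?thesis
    proof (cases "j \<in> G")
      case True
      then have "i \<in> BS"
        using that out by (auto simp: h'_def)
      then show ?thesis
        using scaled_prices_equality_edge_inside[OF u p x assms(9) _ ij] assms(6,10) by simp
    next
      case False
      then show ?thesis
        using scaled_prices_equality_edge_outside[OF u p x _ ij] assms(10) by simp
    qed
  qed
  \<comment> \<open>This is the critical case for budgets: spending grows by the factor
    \<open>x\<close> while the price of the buyer's own good stays fixed.\<close>
  have afford: "x * (p i - ?r i) \<le> p i" if "i \<in> BS" "i \<notin> G" for i
  proof (cases "p i - ?r i = 0")
    \<comment> \<open>With no spending the quotient in \<open>x_surplus\<close> is infinite and
      bounds nothing, but then the claim is just positivity of the price.\<close>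
    case True
    then show ?thesis using p[of i] by simp
  next
    case False
    have "0 \<le> p i - ?r i"
      unfolding rh using m(1) by (simp add: h_def sum_nonneg)
    then have pos: "0 < p i - ?r i"
      using False by simp
    have "ereal x \<le> ereal (p i) / ereal (p i - ?r i)"
      using that assms(6)
      by (intro order_trans[OF assms(8)[unfolded x_surplus_def]] Inf_lower) blast
    then have "x \<le> p i / (p i - ?r i)"
      using False by simp
    then show ?thesis
      using pos by (simp add: pos_le_divide_eq)
  qed
  have "feasible_flow (equality_network u p') f'"
    unfolding f' feasible_flow_of_matrix_iff
  proof (intro conjI allI impI)
    fix i j
    show "0 \<le> h' i j"
      using m(1)[of i j] x by (simp add: h'_def h_def)
    show "h' i j = 0" if "(i, j) \<notin> equality_edges u p'"
      using that E' by blast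
    have px: "p i \<le> x * p i"
      using p[of i] x by simp
    have *: "(\<Sum>j\<in>UNIV. h i j) \<le> p i"
      using m(3)[of i] by (simp add: rh)
    then have "x * (\<Sum>j\<in>UNIV. h i j) \<le> x * p i"
      using x by simp
    then show "(\<Sum>j\<in>UNIV. h' i j) \<le> p' i"
      using px * afford[of i] by (auto simp: row rh assms(10) scaled_prices_def)
    have "(\<Sum>i\<in>UNIV. h i j) \<le> p j"
      using m(4)[of j] by (simp add: gh)
    then show "(\<Sum>i\<in>UNIV. h' i j) \<le> p' j"
      using x by (simp add: col assms(10) scaled_prices_def)
  qed
  moreover have "\<forall>i j. 0 < f' (Buyer i, Good j) \<longrightarrow> (i, j) \<in> equality_edges u p'"
    using E' by (simp add: f')
  \<comment> \<open>Inside \<open>G\<close> price and inflow both scale by \<open>x\<close>, so the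
    surplus does too; it is unchanged because it is zero by \<open>sold\<close>.\<close>
  moreover have "good_surplus p' f' j = good_surplus p f j" for j
  proof -
    have "good_surplus p' f' j = p' j - (\<Sum>i\<in>UNIV. h' i j)"
      by (simp add: good_surplus_def f')
    then show ?thesis
      using sold[of j] by (simp add: gh col assms(10) scaled_prices_def)
  qed
  moreover have "buyer_surplus p' f' i =
       (if i \<in> BS \<and> i \<in> G then x * ?r i
        else if i \<in> BS \<and> i \<notin> G then (1 - x) * p i + x * ?r i
        else if i \<notin> BS \<and> i \<in> G then (x - 1) * p i + ?r i
        else ?r i)" for i
  proof -
    have "buyer_surplus p' f' i = p' i - (\<Sum>j\<in>UNIV. h' i j)"
      by (simp add: buyer_surplus_def f')
    then show ?thesis
      by (simp add: rh row assms(10) scaled_prices_def) (simp add: algebra_simps)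
  qed
  ultimately show ?thesis by blast
qed

end
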